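(* Let $\eta:A^*\to A^*$ be a substitution and $u\in A^{\mathbb{Z}}$ a two-sided periodic point of $\eta$ with growing seed $s=u_{-1}|u_0$, and let $p\ge1$ be the period of $u$. Let $f:\mathbb{Z}\to\{0,1\}\mathcal{D}^*$ be a map. The following are equivalent: (1) $f=\mathrm{rep}_u$; (2) $f$ is increasing with respect to $\prec$, its image is $f(\mathbb{Z})=\bigcup_{\ell\in\mathbb{N}}\mathcal{L}_{\ell p+1}(\mathcal{A}_{\eta,s})\setminus\{0\,\mathtt{W}_{\min},1\,\mathtt{W}_{\max}\}\mathcal{D}^*$, and $f(0)=0$.
   Context: $A$ is a finite alphabet, $A^*$ the finite words, $\varepsilon$ the empty word, $|w|$ the length, $w[i]$ the $i$-th letter (from $0$). A substitution is a morphism $\eta:A^*\to A^*$ with $\eta(a)\neq\varepsilon$ for all $a$ and some letter growing ($|\eta^k(a)|\to\infty$). $\eta$ acts on $u\in A^{\mathbb{Z}}$ by $\eta(\cdots u_{-1}|u_0\cdots)=\cdots\eta(u_{-2})\eta(u_{-1})|\eta(u_0)\eta(u_1)\cdots$ ($|$ separating positions $-1$ and $0$); $u$ is a periodic point if $\eta^p(u)=u$ for some $p\ge1$, its period is the least such $p$; the seed $u_{-1}|u_0$ is growing if both letters are growing. A sequence $(m_i,a_i)_{i=0,\dots,k}$ in $A^*\times A$ is $x$-admissible if $m_{i-1}a_{i-1}$ is a prefix of $\eta(a_i)$ for $1\le i\le k$ and $m_ka_k$ is a prefix of $\eta(x)$. Let $\mathcal{D}=\{0,\dots,\max_c|\eta(c)|-1\}$;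 $\odot$ (or juxtaposition) is concatenation of words over $\mathcal{D}$. For $q\ge1$, $x\in A$, $0\le n<|\eta^q(x)|$ there is a unique $x$-admissible $(m_i,a_i)_{i=0,\dots,q-1}$ with $n=\sum_j|\eta^j(m_j)|$, and $\mathrm{tail}_{\eta,q,x}(n)=|m_{q-1}|\odot\cdots\odot|m_0|$. Set $\mathtt{W}_{\min}=0^p$, $\mathtt{W}_{\max}=\mathrm{tail}_{\eta,p,u_{-1}}(|\eta^p(u_{-1})|-1)$. Numeration system: for $n\ge1$ there are a unique $k$ divisible by $p$ and a unique $u_0$-admissible $(m_i,a_i)_{i=0,\dots,k-1}$ with $m_{k-1}\cdots m_{k-p}\ne\varepsilon$ and $u_0\cdots u_{n-1}=\eta^{k-1}(m_{k-1})\cdots\eta^0(m_0)$; for $n\le-2$ there are a unique $k$ divisible by $p$ and a unique $u_{-1}$-admissible $(m_i,a_i)_{i=0,\dots,k-1}$ with $\eta^{p-1}(m_{k-1})\cdots\eta^0(m_{k-p})a_{k-p}\ne\eta^p(u_{-1})$ and $u_{-|\eta^k(u_{-1})|}\cdots u_{n-1}=\eta^{k-1}(m_{k-1})\cdots\eta^0(m_0)$. Then $\mathrm{rep}_u(n)=0\odot|m_{k-1}|\odot\cdots\odot|m_0|$ ($n\ge1$), $\mathrm{rep}_u(0)=0$, $\mathrm{rep}_u(-1)=1$, $\mathrm{rep}_u(n)=1\odot|m_{k-1}|\odot\cdots\odot|m_0|$ ($n\le-2$). The automaton $\mathcal{A}_{\eta,s}$ has states $A\cup\{\mathtt{start}\}$,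 initial state $\mathtt{start}$, accepting states $A$, partial transitions $\delta(\mathtt{start},0)=u_0$, $\delta(\mathtt{start},1)=u_{-1}$, $\delta(c,i)=\eta(c)[i]$ for $c\in A$, $0\le i<|\eta(c)|$, extended to words; $\mathcal{L}_q(\mathcal{A}_{\eta,s})$ is the set of words $w\in\mathcal{D}^*$ of length $q$ with $\delta(\mathtt{start},w)$ defined and in $A$. Orders: $<_{lex}$ lexicographic on $\mathcal{D}^*$; $u<_{rad}v$ iff $|u|<|v|$ or ($|u|=|v|$ and $u<_{lex}v$); $u<_{rev}v$ iff $|u|>|v|$ or ($|u|=|v|$ and $u<_{lex}v$); for $u,v\in\{0,1\}\mathcal{D}^*$, $u\prec v$ iff ($u\in1\mathcal{D}^*$, $v\in0\mathcal{D}^*$) or ($u,v\in0\mathcal{D}^*$, $u<_{rad}v$) or ($u,v\in1\mathcal{D}^*$, $u<_{rev}v$). *)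

theory Defs
  imports Complex_Main "HOL-Library.Sublist"
begin

definition growing :: "('a list \<Rightarrow> 'a list) \<Rightarrow> 'a \<Rightarrow> bool" where
  "growing \<eta> a \<longleftrightarrow> filterlim (\<lambda>k. length ((\<eta> ^^ k) [a])) at_top sequentially"

definition substitution :: "('a list \<Rightarrow> 'a list) \<Rightarrow> bool" where
  "substitution \<eta> \<longleftrightarrow>
     (\<forall>v w. \<eta> (v @ w) = \<eta> v @ \<eta> w) \<and> (\<forall>a. \<eta> [a] \<noteq> []) \<and> (\<exists>a. growing \<eta> a)"

text \<open>Action on two-sided sequences. Since a substitution is non-erasing, the image of
  \<open>u\<^sub>0 \<dots> u\<^sub>i\<close> reaches position \<open>i\<close> when it is laid out to the right from position \<open>0\<close>, and
  the image of \<open>u\<^sub>i \<dots> u\<^sub>-\<^sub>1\<close> for \<open>i < 0\<close> reaches position \<open>i\<close> when it is laid out to end at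
  position \<open>-1\<close>.\<close>

definition act :: "('a list \<Rightarrow> 'a list) \<Rightarrow> (int \<Rightarrow> 'a) \<Rightarrow> (int \<Rightarrow> 'a)" where
  "act \<eta> u i =
     (if 0 \<le> i then \<eta> (map u [0..i]) ! nat i
      else let w = \<eta> (map u [i..-1]) in w ! nat (int (length w) + i))"

definition periodic_point :: "('a list \<Rightarrow> 'a list) \<Rightarrow> (int \<Rightarrow> 'a) \<Rightarrow> bool" where
  "periodic_point \<eta> u \<longleftrightarrow> (\<exists>p\<ge>1. (act \<eta> ^^ p) u = u)"

definition period :: "('a list \<Rightarrow> 'a list) \<Rightarrow> (int \<Rightarrow> 'a) \<Rightarrow> nat" where
  "period \<eta> u = (LEAST p. 1 \<le> p \<and> (act \<eta> ^^ p) u = u)"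

text \<open>A sequence \<open>(m\<^sub>i, a\<^sub>i)\<close>, \<open>i = 0, \<dots>, k\<close>, is a list of length \<open>k + 1\<close> whose entry at index
  \<open>i\<close> is \<open>(m\<^sub>i, a\<^sub>i)\<close>; in particular it is non-empty.\<close>

definition admissible :: "('a list \<Rightarrow> 'a list) \<Rightarrow> 'a \<Rightarrow> ('a list \<times> 'a) list \<Rightarrow> bool" where
  "admissible \<eta> x ms \<longleftrightarrow>
     ms \<noteq> [] \<and>
     (\<forall>i. 1 \<le> i \<and> i < length ms \<longrightarrow>
        prefix (fst (ms ! (i - 1)) @ [snd (ms ! (i - 1))]) (\<eta> [snd (ms ! i)])) \<and>
     prefix (fst (last ms) @ [snd (last ms)]) (\<eta> [x])"

definition digits :: "('a::finite list \<Rightarrow> 'a list) \<Rightarrow> nat set" where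
  "digits \<eta> = {0..<Max (range (\<lambda>c. length (\<eta> [c])))}"

text \<open>The word \<open>|m\<^sub>k\<^sub>-\<^sub>1| \<odot> \<dots> \<odot> |m\<^sub>0|\<close>.\<close>

definition digit_word :: "('a list \<times> 'a) list \<Rightarrow> nat list" where
  "digit_word ms = rev (map (\<lambda>(m, a). length m) ms)"

definition tail :: "('a list \<Rightarrow> 'a list) \<Rightarrow> nat \<Rightarrow> 'a \<Rightarrow> nat \<Rightarrow> nat list" where
  "tail \<eta> q x n =
     digit_word (THE ms. length ms = q \<and> admissible \<eta> x ms \<and>
       n = (\<Sum>j<q. length ((\<eta> ^^ j) (fst (ms ! j)))))"

definition W_min :: "('a list \<Rightarrow> 'a list) \<Rightarrow> (int \<Rightarrow> 'a) \<Rightarrow> nat list" where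
  "W_min \<eta> u = replicate (period \<eta> u) 0"

definition W_max :: "('a list \<Rightarrow> 'a list) \<Rightarrow> (int \<Rightarrow> 'a) \<Rightarrow> nat list" where
  "W_max \<eta> u =
     tail \<eta> (period \<eta> u) (u (-1)) (length ((\<eta> ^^ period \<eta> u) [u (-1)]) - 1)"

text \<open>The word \<open>\<eta>\<^sup>k\<^sup>-\<^sup>1(m\<^sub>k\<^sub>-\<^sub>1) \<dots> \<eta>\<^sup>0(m\<^sub>0)\<close>.\<close>

definition expansion :: "('a list \<Rightarrow> 'a list) \<Rightarrow> ('a list \<times> 'a) list \<Rightarrow> 'a list" where
  "expansion \<eta> ms = concat (map (\<lambda>i. (\<eta> ^^ i) (fst (ms ! i))) (rev [0..<length ms]))"

definition rep_seq_pos ::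
  "('a list \<Rightarrow> 'a list) \<Rightarrow> (int \<Rightarrow> 'a) \<Rightarrow> int \<Rightarrow> ('a list \<times> 'a) list \<Rightarrow> bool" where
  "rep_seq_pos \<eta> u n ms \<longleftrightarrow>
     (let p = period \<eta> u; k = length ms in
        p dvd k \<and> admissible \<eta> (u 0) ms \<and>
        concat (map (\<lambda>i. fst (ms ! i)) (rev [k - p..<k])) \<noteq> [] \<and>
        map u [0..n - 1] = expansion \<eta> ms)"

text \<open>The bound \<open>-|\<eta>\<^sup>k(u\<^sub>-\<^sub>1)| \<le> n\<close> says that the factor of \<open>u\<close> from position \<open>-|\<eta>\<^sup>k(u\<^sub>-\<^sub>1)|\<close>
  to position \<open>n - 1\<close> is meaningful (and empty only in the case of equality); without it,
  the interval list would collapse to the empty word for all smaller \<open>n\<close>.\<close>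

definition rep_seq_neg ::
  "('a list \<Rightarrow> 'a list) \<Rightarrow> (int \<Rightarrow> 'a) \<Rightarrow> int \<Rightarrow> ('a list \<times> 'a) list \<Rightarrow> bool" where
  "rep_seq_neg \<eta> u n ms \<longleftrightarrow>
     (let p = period \<eta> u; k = length ms; N = int (length ((\<eta> ^^ k) [u (-1)])) in
        p dvd k \<and> admissible \<eta> (u (-1)) ms \<and>
        expansion \<eta> (drop (k - p) ms) @ [snd (ms ! (k - p))] \<noteq> (\<eta> ^^ p) [u (-1)] \<and>
        - N \<le> n \<and> map u [- N..n - 1] = expansion \<eta> ms)"

definition rep :: "('a list \<Rightarrow> 'a list) \<Rightarrow> (int \<Rightarrow> 'a) \<Rightarrow> int \<Rightarrow> nat list" where
  "rep \<eta> u n =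
     (if 1 \<le> n then 0 # digit_word (THE ms. rep_seq_pos \<eta> u n ms)
      else if n = 0 then [0]
      else if n = -1 then [1]
      else 1 # digit_word (THE ms. rep_seq_neg \<eta> u n ms))"

datatype 'a state = Start | Letter 'a

text \<open>The seed \<open>u\<^sub>-\<^sub>1|u\<^sub>0\<close> is the pair \<open>(u\<^sub>-\<^sub>1, u\<^sub>0)\<close>.\<close>

fun delta :: "('a list \<Rightarrow> 'a list) \<Rightarrow> 'a \<times> 'a \<Rightarrow> 'a state \<Rightarrow> nat \<Rightarrow> 'a state option" where
  "delta \<eta> s Start d =
     (if d = 0 then Some (Letter (snd s)) else if d = 1 then Some (Letter (fst s)) else None)"
| "delta \<eta> s (Letter c) d =
     (if d < length (\<eta> [c]) then Some (Letter (\<eta> [c] ! d)) else None)"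

fun delta_word ::
  "('a list \<Rightarrow> 'a list) \<Rightarrow> 'a \<times> 'a \<Rightarrow> 'a state \<Rightarrow> nat list \<Rightarrow> 'a state option" where
  "delta_word \<eta> s q [] = Some q"
| "delta_word \<eta> s q (d # w) = Option.bind (delta \<eta> s q d) (\<lambda>q'. delta_word \<eta> s q' w)"

definition lang :: "('a::finite list \<Rightarrow> 'a list) \<Rightarrow> 'a \<times> 'a \<Rightarrow> nat \<Rightarrow> nat list set" where
  "lang \<eta> s q =
     {w \<in> lists (digits \<eta>). length w = q \<and> (\<exists>c. delta_word \<eta> s Start w = Some (Letter c))}"

definition words_from :: "nat list set \<Rightarrow> nat set \<Rightarrow> nat list set" where
  "words_from X D = {x @ v | x v. x \<in> X \<and> v \<in> lists D}"

definition less_lex :: "nat list \<Rightarrow> nat list \<Rightarrow> bool" where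
  "less_lex v w \<longleftrightarrow> (v, w) \<in> lexord less_than"

definition less_rad :: "nat list \<Rightarrow> nat list \<Rightarrow> bool" where
  "less_rad v w \<longleftrightarrow> length v < length w \<or> (length v = length w \<and> less_lex v w)"

definition less_rev :: "nat list \<Rightarrow> nat list \<Rightarrow> bool" where
  "less_rev v w \<longleftrightarrow> length v > length w \<or> (length v = length w \<and> less_lex v w)"

definition prec :: "nat set \<Rightarrow> nat list \<Rightarrow> nat list \<Rightarrow> bool" where
  "prec D v w \<longleftrightarrow>
     (v \<in> words_from {[1]} D \<and> w \<in> words_from {[0]} D) \<or>
     (v \<in> words_from {[0]} D \<and> w \<in> words_from {[0]} D \<and> less_rad v w) \<or>
     (v \<in> words_from {[1]} D \<and> w \<in> words_from {[1]} D \<and> less_rev v w)"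

end

theory Submission
  imports Defs
begin

text \<open>A digit word of length \<open>k\<close> read by the automaton from a letter \<open>x\<close> addresses one letter of
  \<open>\<eta>\<^sup>k(x)\<close>, and for fixed \<open>k\<close> the lexicographic order is the order of positions. Rank the words
  after \<open>0\<close> by the number of letters of \<open>\<eta>\<^sup>k(u\<^sub>0)\<close> before the addressed one, and the words after
  \<open>1\<close> by the number of letters of \<open>\<eta>\<^sup>k(u\<^sub>-\<^sub>1)\<close> behind it. Since \<open>\<eta>\<^sup>p(u\<^sub>0)\<close> begins with \<open>u\<^sub>0\<close> and
  \<open>\<eta>\<^sup>p(u\<^sub>-\<^sub>1)\<close> ends with \<open>u\<^sub>-\<^sub>1\<close>, a leading block \<open>W\<^sub>min\<close>, respectively \<open>W\<^sub>max\<close>, does not change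
  the rank, and any other leading block makes it exceed all ranks of shorter words. Hence every
  rank is attained by exactly one word without such a leading block, which is the word chosen by
  \<open>rep\<close>. So \<open>rep\<close> is an increasing enumeration of the language by the integers, and an increasing
  enumeration by the integers is determined by its value at \<open>0\<close>.\<close>

section \<open>Words, orders and enumerations by the integers\<close>

lemma funpow_add_apply: "(f ^^ (m + n)) x = (f ^^ n) ((f ^^ m) x)"
  by (simp add: add.commute[of m] funpow_add)

lemma prefix_iff_take: "prefix v w \<longleftrightarrow> take (length v) w = v"
  by (metis append_eq_conv_conj prefix_def take_is_prefix)

lemma prefix_snoc_iff_take_nth:
  "prefix (m @ [a]) w \<longleftrightarrow> length m < length w \<and> m = take (length m) w \<and> a = w ! length m"
  by (auto simp: prefix_def) (metis append_take_drop_id Cons_nth_drop_Suc)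

lemma nth_eq_if_prefix:
  assumes "prefix v w \<or> prefix w v" "i < length v" "i < length w"
  shows "v ! i = w ! i"
  using assms by (auto simp: prefix_def nth_append)

lemma prefix_map_upto: "j \<le> k \<Longrightarrow> prefix (map u [i..j]) (map u [i..k])"
  using upto_split2[of i j k] by (cases "i \<le> j") auto

lemma suffix_map_upto: "i \<le> j \<Longrightarrow> suffix (map u [j..k]) (map u [i..k])"
  using upto_split1[of i j k] by (cases "j \<le> k") (auto simp: suffix_def)

lemma map_upto_eq_prefix_iff:
  assumes "prefix v (map u [a..b])" "a \<le> n"
  shows "map u [a..n - 1] = v \<longleftrightarrow> n = a + int (length v)"
proof
  assume "map u [a..n - 1] = v"
  then show "n = a + int (length v)" using assms(2) by auto
next
  assume n_eq: "n = a + int (length v)"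
  show "map u [a..n - 1] = v"
  proof (rule nth_equalityI)
    fix i assume "i < length (map u [a..n - 1])"
    then have i_less: "i < length v" using n_eq by simp
    also have "length v \<le> nat (b - a + 1)" using prefix_length_le[OF assms(1)] by simp
    finally have i_in_range: "i < nat (b - a + 1)" .
    have "v ! i = map u [a..b] ! i"
      using assms(1) i_less i_in_range by (intro nth_eq_if_prefix) auto
    then show "map u [a..n - 1] ! i = v ! i" using n_eq i_less i_in_range by simp
  qed (use n_eq in simp)
qed

lemma less_lex_linear: "less_lex v w \<or> v = w \<or> less_lex w v"
  unfolding less_lex_def by (rule lexord_linear) auto

lemma less_lex_asym: "less_lex v w \<Longrightarrow> \<not> less_lex w v"
  unfolding less_lex_def by (rule lexord_asymmetric) (auto intro: asymI)

lemma mem_words_from_iff: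
  assumes "w \<in> lists D"
  shows "w \<in> words_from X D \<longleftrightarrow> (\<exists>x\<in>X. prefix x w)"
  using assms by (fastforce simp: words_from_def prefix_def)

lemma Cons_mem_words_from_singleton: "d # w \<in> words_from {[e]} D \<longleftrightarrow> d = e \<and> w \<in> lists D"
  by (auto simp: words_from_def)

lemma prec_asym: "prec D v w \<Longrightarrow> \<not> prec D w v"
proof -
  have "\<not> (v \<in> words_from {[0]} D \<and> v \<in> words_from {[1]} D)" for v
    by (auto simp: words_from_def)
  then show "prec D v w \<Longrightarrow> \<not> prec D w v"
    using less_lex_asym unfolding prec_def less_rad_def less_rev_def by (metis less_asym)
qed

lemma strict_mono_surj_int_eq_id:
  fixes g :: "int \<Rightarrow> int"
  assumes mono: "strict_mono g" and surj: "surj g" and zero: "g 0 = 0"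
  shows "g n = n"
proof -
  have g_succ: "g (k + 1) = g k + 1" for k
  proof -
    obtain j where g_j: "g j = g k + 1" using surj by (metis surjD)
    then have "k < j" using strict_mono_less[OF mono, of k j] by simp
    moreover have "g k < g (k + 1)" using strict_mono_less[OF mono, of k "k + 1"] by simp
    then have "j \<le> k + 1" using g_j strict_mono_less_eq[OF mono, of j "k + 1"] by simp
    ultimately have "j = k + 1" by simp
    with g_j show ?thesis by simp
  qed
  show ?thesis
  proof (induction n rule: int_induct[of _ 0])
    case (step1 i)
    then show ?case by (simp add: g_succ)
  next
    case (step2 i)
    then show ?case using g_succ[of "i - 1"] by simp
  qed (rule zero)
qed

lemma increasing_int_enumeration_unique:
  fixes e f :: "int \<Rightarrow> 'b"
  assumes asym: "\<And>s t. R s t \<Longrightarrow> \<not> R t s"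
    and e_mono: "\<And>m n. m < n \<Longrightarrow> R (e m) (e n)" and f_mono: "\<And>m n. m < n \<Longrightarrow> R (f m) (f n)"
    and range_eq: "range f = range e" and zero: "f 0 = e 0"
  shows "f = e"
proof -
  have e_inj: "inj e" by (rule linorder_injI) (metis e_mono asym)
  define g where "g = (\<lambda>n. inv e (f n))"
  have e_g: "e (g n) = f n" for n
    unfolding g_def using range_eq by (metis f_inv_into_f rangeI)
  have "strict_mono g"
  proof (rule strict_monoI)
    fix m n :: int assume "m < n"
    then have "R (e (g m)) (e (g n))" using f_mono e_g by simp
    then show "g m < g n" by (metis asym e_mono linorder_neqE)
  qed
  moreover have "surj g"
    unfolding surj_def using e_g e_inj range_eq by (metis injD imageE rangeI)
  moreover have "g 0 = 0" using zero e_inj by (simp add: g_def)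
  ultimately have "g n = n" for n by (rule strict_mono_surj_int_eq_id)
  then show "f = e" using e_g by fastforce
qed

section \<open>Addresses and admissible sequences\<close>

primrec address :: "('a list \<Rightarrow> 'a list) \<Rightarrow> 'a \<Rightarrow> nat list \<Rightarrow> bool" where
  "address \<eta> x [] \<longleftrightarrow> True"
| "address \<eta> x (d # w) \<longleftrightarrow> d < length (\<eta> [x]) \<and> address \<eta> (\<eta> [x] ! d) w"

primrec letter_at :: "('a list \<Rightarrow> 'a list) \<Rightarrow> 'a \<Rightarrow> nat list \<Rightarrow> 'a" where
  "letter_at \<eta> x [] = x"
| "letter_at \<eta> x (d # w) = letter_at \<eta> (\<eta> [x] ! d) w"

primrec prefix_before :: "('a list \<Rightarrow> 'a list) \<Rightarrow> 'a \<Rightarrow> nat list \<Rightarrow> 'a list" where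
  "prefix_before \<eta> x [] = []"
| "prefix_before \<eta> x (d # w) =
    (\<eta> ^^ length w) (take d (\<eta> [x])) @ prefix_before \<eta> (\<eta> [x] ! d) w"

primrec suffix_after :: "('a list \<Rightarrow> 'a list) \<Rightarrow> 'a \<Rightarrow> nat list \<Rightarrow> 'a list" where
  "suffix_after \<eta> x [] = []"
| "suffix_after \<eta> x (d # w) =
    suffix_after \<eta> (\<eta> [x] ! d) w @ (\<eta> ^^ length w) (drop (Suc d) (\<eta> [x]))"

abbreviation position :: "('a list \<Rightarrow> 'a list) \<Rightarrow> 'a \<Rightarrow> nat list \<Rightarrow> nat" where
  "position \<eta> x w \<equiv> length (prefix_before \<eta> x w)"

abbreviation coposition :: "('a list \<Rightarrow> 'a list) \<Rightarrow> 'a \<Rightarrow> nat list \<Rightarrow> nat" where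
  "coposition \<eta> x w \<equiv> length (suffix_after \<eta> x w)"

text \<open>Digit words list the highest level first, admissible sequences the lowest.\<close>

primrec path :: "('a list \<Rightarrow> 'a list) \<Rightarrow> 'a \<Rightarrow> nat list \<Rightarrow> ('a list \<times> 'a) list" where
  "path \<eta> x [] = []"
| "path \<eta> x (d # w) = path \<eta> (\<eta> [x] ! d) w @ [(take d (\<eta> [x]), \<eta> [x] ! d)]"

lemma address_append: "address \<eta> x (v @ w) \<longleftrightarrow> address \<eta> x v \<and> address \<eta> (letter_at \<eta> x v) w"
  by (induction v arbitrary: x) auto

lemma address_take: "address \<eta> x w \<Longrightarrow> address \<eta> x (take k w)"
  by (metis address_append append_take_drop_id)

lemma delta_word_Letter:
  "delta_word \<eta> s (Letter x) w =
    (if address \<eta> x w then Some (Letter (letter_at \<eta> x w)) else None)"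
  by (induction w arbitrary: x) auto

lemma length_image_le_Max:
  fixes \<eta> :: "'a::finite list \<Rightarrow> 'a list"
  shows "length (\<eta> [a]) \<le> Max (range (\<lambda>c. length (\<eta> [c])))"
  by (rule Max_ge) auto

lemma address_imp_digits:
  fixes \<eta> :: "'a::finite list \<Rightarrow> 'a list"
  shows "address \<eta> x w \<Longrightarrow> w \<in> lists (digits \<eta>)"
proof (induction w arbitrary: x)
  case (Cons d w)
  then show ?case
    using less_le_trans[OF _ length_image_le_Max[of \<eta> x], of d] by (auto simp: digits_def)
qed simp

lemma length_path [simp]: "length (path \<eta> x w) = length w"
  by (induction w arbitrary: x) auto

lemma path_eq_Nil_iff [simp]: "path \<eta> x w = [] \<longleftrightarrow> w = []"
  by (cases w) auto

lemma path_append: "path \<eta> x (v @ w) = path \<eta> (letter_at \<eta> x v) w @ path \<eta> x v"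
  by (induction v arbitrary: x) auto

lemma drop_path: "drop (length w - k) (path \<eta> x w) = path \<eta> x (take k w)"
  using path_append[of \<eta> x "take k w" "drop k w"] by simp

lemma snd_hd_path: "w \<noteq> [] \<Longrightarrow> snd (hd (path \<eta> x w)) = letter_at \<eta> x w"
proof (induction w arbitrary: x)
  case (Cons d w)
  then show ?case by (cases "w = []") (auto simp: hd_append)
qed simp

lemma digit_word_path: "address \<eta> x w \<Longrightarrow> digit_word (path \<eta> x w) = w"
  by (induction w arbitrary: x) (auto simp: digit_word_def)

lemma expansion_Nil: "expansion \<eta> [] = []"
  by (simp add: expansion_def)

lemma expansion_snoc: "expansion \<eta> (ms @ [y]) = (\<eta> ^^ length ms) (fst y) @ expansion \<eta> ms"
  by (auto simp: expansion_def nth_append intro!: arg_cong[where f = concat] map_cong)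

lemma expansion_path: "expansion \<eta> (path \<eta> x w) = prefix_before \<eta> x w"
  by (induction w arbitrary: x) (simp_all add: expansion_Nil expansion_snoc)

lemma length_expansion:
  "length (expansion \<eta> ms) = (\<Sum>j<length ms. length ((\<eta> ^^ j) (fst (ms ! j))))"
  by (induction ms rule: rev_induct) (simp_all add: expansion_Nil expansion_snoc nth_append)

lemma admissible_snoc:
  "admissible \<eta> x (ms @ [y]) \<longleftrightarrow>
     prefix (fst y @ [snd y]) (\<eta> [x]) \<and> (ms = [] \<or> admissible \<eta> (snd y) ms)"
proof -
  have all_less_Suc: "(\<forall>i. 1 \<le> i \<and> i < Suc n \<longrightarrow> P i) \<longleftrightarrow>
      (\<forall>i. 1 \<le> i \<and> i < n \<longrightarrow> P i) \<and> (1 \<le> n \<longrightarrow> P n)" for P and n :: nat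
    by (auto simp: less_Suc_eq)
  show ?thesis
    unfolding admissible_def length_append_singleton all_less_Suc
    by (auto simp: nth_append Suc_le_eq last_conv_nth)
qed

lemma admissible_path: "address \<eta> x w \<Longrightarrow> w \<noteq> [] \<Longrightarrow> admissible \<eta> x (path \<eta> x w)"
proof (induction w arbitrary: x)
  case (Cons d w)
  then show ?case
    by (cases "w = []") (auto simp: admissible_snoc prefix_snoc_iff_take_nth
        admissible_snoc[of \<eta> x "[]", simplified])
qed simp

lemma admissible_imp_path:
  assumes "admissible \<eta> x ms"
  obtains w where "address \<eta> x w" "w \<noteq> []" "ms = path \<eta> x w"
  using assms
proof (induction ms arbitrary: x thesis rule: rev_induct)
  case Nil
  then show ?case by (simp add: admissible_def)
next
  case (snoc y ms)
  have last_digit: "length (fst y) < length (\<eta> [x])"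
      "y = (take (length (fst y)) (\<eta> [x]), \<eta> [x] ! length (fst y))"
    and rest: "ms = [] \<or> admissible \<eta> (snd y) ms"
    using snoc.prems(2) by (auto simp: admissible_snoc prefix_snoc_iff_take_nth prod_eq_iff)
  obtain w where "address \<eta> (snd y) w" "ms = path \<eta> (snd y) w"
    using rest snoc.IH[of "snd y"] by (metis address.simps(1) path.simps(1))
  then show ?case
    using last_digit by (intro snoc.prems(1)[of "length (fst y) # w"]) (auto simp: prod_eq_iff)
qed

lemma digit_word_The_eqI:
  assumes "address \<eta> x w" "w \<noteq> []" "\<And>ms. P ms \<Longrightarrow> admissible \<eta> x ms"
    and "\<And>v. address \<eta> x v \<Longrightarrow> v \<noteq> [] \<Longrightarrow> P (path \<eta> x v) \<longleftrightarrow> v = w"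
  shows "digit_word (THE ms. P ms) = w"
proof -
  have "(THE ms. P ms) = path \<eta> x w"
    using assms by (intro the_equality) (auto elim: admissible_imp_path)
  then show ?thesis using assms(1) by (simp add: digit_word_path)
qed

section \<open>Non-erasing morphisms\<close>

locale nonerasing =
  fixes \<eta> :: "'a list \<Rightarrow> 'a list"
  assumes append: "\<eta> (v @ w) = \<eta> v @ \<eta> w" and nonempty: "\<eta> [a] \<noteq> []"
begin

lemma image_Nil [simp]: "\<eta> [] = []"
  using append[of "[]" "[]"] by simp

lemma funpow_append: "(\<eta> ^^ k) (v @ w) = (\<eta> ^^ k) v @ (\<eta> ^^ k) w"
  by (induction k) (auto simp: append)

lemma funpow_Nil [simp]: "(\<eta> ^^ k) [] = []"
  by (induction k) auto

lemma length_le: "length w \<le> length (\<eta> w)"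
proof (induction w)
  case (Cons a w)
  have "1 \<le> length (\<eta> [a])" using nonempty[of a] by (simp add: Suc_le_eq)
  with Cons show ?case using append[of "[a]" w] by simp
qed simp

lemma length_funpow_mono: "i \<le> j \<Longrightarrow> length ((\<eta> ^^ i) w) \<le> length ((\<eta> ^^ j) w)"
  by (rule lift_Suc_mono_le[where f = "\<lambda>k. length ((\<eta> ^^ k) w)"]) (auto intro: length_le)

lemma funpow_eq_Nil_iff: "(\<eta> ^^ k) w = [] \<longleftrightarrow> w = []"
  using length_funpow_mono[of 0 k w] by auto

lemma prefix_image: "prefix v w \<Longrightarrow> prefix (\<eta> v) (\<eta> w)"
  by (auto simp: prefix_def append)

lemma suffix_image: "suffix v w \<Longrightarrow> suffix (\<eta> v) (\<eta> w)"
  by (auto simp: suffix_def append)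

lemma prefix_before_append:
  "prefix_before \<eta> x (v @ w) =
    (\<eta> ^^ length w) (prefix_before \<eta> x v) @ prefix_before \<eta> (letter_at \<eta> x v) w"
  by (induction v arbitrary: x) (simp_all add: funpow_append funpow_add_apply)

lemma suffix_after_append:
  "suffix_after \<eta> x (v @ w) =
    suffix_after \<eta> (letter_at \<eta> x v) w @ (\<eta> ^^ length w) (suffix_after \<eta> x v)"
  by (induction v arbitrary: x) (simp_all add: funpow_append funpow_add_apply)

lemma prefix_before_eq_Nil_iff:
  "address \<eta> x w \<Longrightarrow> prefix_before \<eta> x w = [] \<longleftrightarrow> w = replicate (length w) 0"
  by (induction w arbitrary: x) (auto simp: funpow_eq_Nil_iff nonempty)

lemma funpow_eq_address_split:
  "address \<eta> x w \<Longrightarrow>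
    (\<eta> ^^ length w) [x] = prefix_before \<eta> x w @ letter_at \<eta> x w # suffix_after \<eta> x w"
proof (induction w arbitrary: x)
  case (Cons d w)
  let ?y = "\<eta> [x] ! d"
  have "\<eta> [x] = take d (\<eta> [x]) @ [?y] @ drop (Suc d) (\<eta> [x])"
    using Cons.prems by (simp add: id_take_nth_drop)
  then have "(\<eta> ^^ length (d # w)) [x] = (\<eta> ^^ length w) (take d (\<eta> [x])) @
      (\<eta> ^^ length w) [?y] @ (\<eta> ^^ length w) (drop (Suc d) (\<eta> [x]))"
    by (metis funpow_append funpow_simps_right(2) length_Cons o_apply)
  then show ?case using Cons by simp
qed simp

lemma length_funpow_address:
  "address \<eta> x w \<Longrightarrow>
    length ((\<eta> ^^ length w) [x]) = position \<eta> x w + Suc (coposition \<eta> x w)"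
  by (simp add: funpow_eq_address_split)

lemma position_less_if_less_lex:
  assumes "address \<eta> x v" "address \<eta> x w" "length v = length w" "less_lex v w"
  shows "position \<eta> x v < position \<eta> x w"
  using assms
proof (induction v arbitrary: x w)
  case Nil
  then show ?case by (simp add: less_lex_def)
next
  case (Cons d v)
  then obtain e w' where w_eq: "w = e # w'" "length v = length w'" by (cases w) auto
  show ?case
  proof (cases "d = e")
    case True
    with Cons w_eq show ?thesis by (auto simp: less_lex_def)
  next
    case False
    then have "d < e" using Cons.prems w_eq by (auto simp: less_lex_def)
    let ?k = "length v" and ?y = "\<eta> [x] ! d"
    have "position \<eta> ?y v < length ((\<eta> ^^ ?k) [?y])"
      using Cons.prems length_funpow_address[of ?y v] by simp
    then have "position \<eta> x (d # v) < length ((\<eta> ^^ ?k) (take (Suc d) (\<eta> [x])))"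
      using Cons.prems by (simp add: take_Suc_conv_app_nth funpow_append)
    also have "take e (\<eta> [x]) = take (Suc d) (\<eta> [x]) @ take (e - Suc d) (drop (Suc d) (\<eta> [x]))"
      using \<open>d < e\<close> by (metis Suc_leI le_add_diff_inverse take_add)
    then have "length ((\<eta> ^^ ?k) (take (Suc d) (\<eta> [x]))) \<le> position \<eta> x w"
      using w_eq by (simp add: funpow_append)
    finally show ?thesis .
  qed
qed

lemma position_less_iff_less_lex:
  assumes "address \<eta> x v" "address \<eta> x w" "length v = length w"
  shows "position \<eta> x v < position \<eta> x w \<longleftrightarrow> less_lex v w"
  using position_less_if_less_lex[of x v w] position_less_if_less_lex[of x w v]
    less_lex_linear[of v w] assms by fastforce

lemma coposition_less_iff_less_lex:
  assumes "address \<eta> x v" "address \<eta> x w" "length v = length w"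
  shows "coposition \<eta> x v < coposition \<eta> x w \<longleftrightarrow> less_lex w v"
  using position_less_iff_less_lex[of x w v] length_funpow_address[of x v]
    length_funpow_address[of x w] assms by auto

lemma ex_digit_covering:
  assumes "n < length ((\<eta> ^^ k) w)"
  obtains d where "d < length w" "length ((\<eta> ^^ k) (take d w)) \<le> n"
    "n < length ((\<eta> ^^ k) (take d w)) + length ((\<eta> ^^ k) [w ! d])"
  using assms
proof (induction w arbitrary: thesis rule: rev_induct)
  case (snoc a w)
  show ?case
  proof (cases "n < length ((\<eta> ^^ k) w)")
    case True
    then obtain d where "d < length w" "length ((\<eta> ^^ k) (take d w)) \<le> n"
      "n < length ((\<eta> ^^ k) (take d w)) + length ((\<eta> ^^ k) [w ! d])"
      using snoc.IH by blast
    then show ?thesis by (intro snoc.prems(1)[of d]) (auto simp: nth_append)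
  next
    case False
    with snoc.prems(2) show ?thesis
      by (intro snoc.prems(1)[of "length w"]) (auto simp: funpow_append)
  qed
qed simp

lemma ex_address_of_position:
  "n < length ((\<eta> ^^ k) [x]) \<Longrightarrow> \<exists>w. address \<eta> x w \<and> length w = k \<and> position \<eta> x w = n"
proof (induction k arbitrary: x n)
  case (Suc k)
  have "n < length ((\<eta> ^^ k) (\<eta> [x]))" using Suc.prems by (simp add: funpow_swap1)
  then obtain d where covering: "d < length (\<eta> [x])" "length ((\<eta> ^^ k) (take d (\<eta> [x]))) \<le> n"
    "n < length ((\<eta> ^^ k) (take d (\<eta> [x]))) + length ((\<eta> ^^ k) [\<eta> [x] ! d])"
    by (rule ex_digit_covering)
  have "n - length ((\<eta> ^^ k) (take d (\<eta> [x]))) < length ((\<eta> ^^ k) [\<eta> [x] ! d])"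
    using covering by linarith
  from Suc.IH[OF this] obtain w where "address \<eta> (\<eta> [x] ! d) w" "length w = k"
    "position \<eta> (\<eta> [x] ! d) w = n - length ((\<eta> ^^ k) (take d (\<eta> [x])))" by blast
  with covering show ?case by (intro exI[of _ "d # w"]) auto
qed simp

lemma bij_betw_position:
  "bij_betw (position \<eta> x) {w. address \<eta> x w \<and> length w = k} {..<length ((\<eta> ^^ k) [x])}"
proof (rule bij_betw_imageI)
  show "inj_on (position \<eta> x) {w. address \<eta> x w \<and> length w = k}"
  proof (rule inj_onI)
    fix v w
    assume "v \<in> {w. address \<eta> x w \<and> length w = k}" "w \<in> {w. address \<eta> x w \<and> length w = k}"
      and "position \<eta> x v = position \<eta> x w"
    then show "v = w"
      using less_lex_linear[of v w] position_less_if_less_lex[of x v w]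
        position_less_if_less_lex[of x w v] by auto
  qed
  show "position \<eta> x ` {w. address \<eta> x w \<and> length w = k} = {..<length ((\<eta> ^^ k) [x])}"
  proof (intro equalityI subsetI)
    fix n assume "n \<in> position \<eta> x ` {w. address \<eta> x w \<and> length w = k}"
    then show "n \<in> {..<length ((\<eta> ^^ k) [x])}" using length_funpow_address by fastforce
  next
    fix n assume "n \<in> {..<length ((\<eta> ^^ k) [x])}"
    then show "n \<in> position \<eta> x ` {w. address \<eta> x w \<and> length w = k}"
      using ex_address_of_position[of n k x] by blast
  qed
qed

lemma bij_betw_coposition:
  "bij_betw (coposition \<eta> x) {w. address \<eta> x w \<and> length w = k} {..<length ((\<eta> ^^ k) [x])}"
proof -
  let ?N = "length ((\<eta> ^^ k) [x])"
  have "bij_betw (\<lambda>n. ?N - Suc n) {..<?N} {..<?N}"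
    by (rule bij_betw_byWitness[where f' = "\<lambda>n. ?N - Suc n"]) auto
  with bij_betw_position
  have "bij_betw ((\<lambda>n. ?N - Suc n) \<circ> position \<eta> x) {w. address \<eta> x w \<and> length w = k} {..<?N}"
    by (rule bij_betw_trans)
  then show ?thesis
    by (rule bij_betw_cong[THEN iffD1, rotated]) (use length_funpow_address in fastforce)
qed

lemma tail_eqI:
  assumes "address \<eta> x w" "length w = q" "q \<noteq> 0" "position \<eta> x w = n"
  shows "tail \<eta> q x n = w"
  unfolding tail_def
proof (rule digit_word_The_eqI)
  fix v assume address_v: "address \<eta> x v" "v \<noteq> []"
  have "n = (\<Sum>j<length v. length ((\<eta> ^^ j) (fst (path \<eta> x v ! j)))) \<longleftrightarrow> position \<eta> x v = n"
    using length_expansion[of \<eta> "path \<eta> x v"] by (auto simp: expansion_path)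
  then show "(length (path \<eta> x v) = q \<and> admissible \<eta> x (path \<eta> x v) \<and>
      n = (\<Sum>j<q. length ((\<eta> ^^ j) (fst (path \<eta> x v ! j))))) \<longleftrightarrow> v = w"
    using address_v assms admissible_path[OF address_v]
      bij_betw_imp_inj_on[OF bij_betw_position[of x q]]
    by (auto dest: inj_onD)
qed (use assms in auto)

lemma expansion_eq_Nil_iff: "expansion \<eta> ms = [] \<longleftrightarrow> (\<forall>y \<in> set ms. fst y = [])"
  by (induction ms rule: rev_induct)
    (auto simp: expansion_Nil expansion_snoc funpow_eq_Nil_iff)

lemma concat_leading_eq_Nil_iff:
  "concat (map (\<lambda>i. fst (ms ! i)) (rev [k..<length ms])) = [] \<longleftrightarrow> expansion \<eta> (drop k ms) = []"
proof -
  have "map (\<lambda>i. fst (ms ! i)) [k..<length ms] = map fst (drop k ms)"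
    by (rule nth_equalityI) simp_all
  then show ?thesis by (simp add: expansion_eq_Nil_iff flip: rev_map)
qed

lemma act_eq_nth_image:
  assumes "i < length (\<eta> (map u [0..int n - 1]))"
  shows "act \<eta> u (int i) = \<eta> (map u [0..int n - 1]) ! i"
proof -
  have "length (map u [0..int i]) \<le> length (\<eta> (map u [0..int i]))" by (rule length_le)
  then have "i < length (\<eta> (map u [0..int i]))" by simp
  moreover have "prefix (map u [0..int i]) (map u [0..int n - 1]) \<or>
      prefix (map u [0..int n - 1]) (map u [0..int i])"
    using linear[of "int i" "int n - 1"] prefix_map_upto by blast
  ultimately have "\<eta> (map u [0..int i]) ! i = \<eta> (map u [0..int n - 1]) ! i"
    using assms by (intro nth_eq_if_prefix) (auto intro: prefix_image)
  then show ?thesis by (simp add: act_def)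
qed

lemma act_eq_nth_rev_image:
  assumes "i < length (\<eta> (map u [- int n..-1]))"
  shows "act \<eta> u (- 1 - int i) = rev (\<eta> (map u [- int n..-1])) ! i"
proof -
  let ?v = "map u [- 1 - int i..-1]"
  have "length ?v \<le> length (\<eta> ?v)" by (rule length_le)
  then have i_less: "i < length (\<eta> ?v)" by simp
  have "suffix ?v (map u [- int n..-1]) \<or> suffix (map u [- int n..-1]) ?v"
    using linear[of "- int n" "- 1 - int i"] suffix_map_upto by blast
  then have "rev (\<eta> ?v) ! i = rev (\<eta> (map u [- int n..-1])) ! i"
    using assms i_less
    by (intro nth_eq_if_prefix) (auto simp flip: suffix_to_prefix intro: suffix_image)
  moreover have "nat (int (length (\<eta> ?v)) + (- 1 - int i)) = length (\<eta> ?v) - Suc i"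
    using i_less by linarith
  ultimately show ?thesis using i_less by (simp add: act_def Let_def rev_nth)
qed

lemma map_act_right:
  "map (act \<eta> u) [0..int (length (\<eta> (map u [0..int n - 1]))) - 1] = \<eta> (map u [0..int n - 1])"
  by (rule nth_equalityI) (simp_all add: act_eq_nth_image)

lemma map_act_left:
  "map (act \<eta> u) [- int (length (\<eta> (map u [- int n..-1])))..-1] = \<eta> (map u [- int n..-1])"
  (is "map _ [- int (length ?w)..-1] = _")
proof (rule nth_equalityI)
  fix i assume "i < length (map (act \<eta> u) [- int (length ?w)..-1])"
  then have i_less: "i < length ?w" by simp
  then have "int i - int (length ?w) = - 1 - int (length ?w - Suc i)" by linarith
  then have "act \<eta> u (int i - int (length ?w)) = rev ?w ! (length ?w - Suc i)"
    using i_less by (simp only: act_eq_nth_rev_image)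
  then show "map (act \<eta> u) [- int (length ?w)..-1] ! i = ?w ! i"
    using i_less by (simp add: rev_nth)
qed simp

lemma funpow_act_right:
  "map ((act \<eta> ^^ k) u) [0..int (length ((\<eta> ^^ k) [u 0])) - 1] = (\<eta> ^^ k) [u 0]"
proof (induction k)
  case (Suc k)
  then show ?case
    using map_act_right[of "(act \<eta> ^^ k) u" "length ((\<eta> ^^ k) [u 0])"] by simp
qed simp

lemma funpow_act_left:
  "map ((act \<eta> ^^ k) u) [- int (length ((\<eta> ^^ k) [u (-1)]))..-1] = (\<eta> ^^ k) [u (-1)]"
proof (induction k)
  case (Suc k)
  then show ?case
    using map_act_left[of "(act \<eta> ^^ k) u" "length ((\<eta> ^^ k) [u (-1)])"] by simp
qed simp

lemma growing_imp_ex_long_image: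
  assumes "growing \<eta> x"
  obtains c where "1 < length (\<eta> [c])"
proof (rule ccontr)
  assume "\<not> thesis"
  then have length_le_1: "length (\<eta> [c]) \<le> 1" for c using that by (meson not_less)
  have "length (\<eta> w) \<le> length w" for w
  proof (induction w)
    case (Cons a w)
    with length_le_1[of a] show ?case using append[of "[a]" w] by simp
  qed simp
  then have "length ((\<eta> ^^ k) [x]) \<le> 1" for k
    by (induction k) (auto intro: order_trans)
  moreover have "\<exists>k. 2 \<le> length ((\<eta> ^^ k) [x])"
    using assms unfolding growing_def filterlim_at_top eventually_sequentially by blast
  ultimately show False by (metis not_less_eq_eq numeral_2_eq_2 One_nat_def)
qed

lemma growing_imp_unbounded:
  assumes "growing \<eta> x" "0 < p"
  shows "\<exists>l. n < length ((\<eta> ^^ (l * p)) [x])"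
proof -
  obtain k where long: "\<forall>j\<ge>k. Suc n \<le> length ((\<eta> ^^ j) [x])"
    using assms unfolding growing_def filterlim_at_top eventually_sequentially by blast
  have "k \<le> k * p" using assms(2) by simp
  with long show ?thesis by (intro exI[of _ k]) (auto simp: Suc_le_eq)
qed

end

section \<open>Numeration by words without a neutral leading block\<close>

locale block_numeration =
  fixes words :: "'d list set" and rank :: "'d list \<Rightarrow> nat" and bound :: "nat \<Rightarrow> nat"
    and p :: nat and neutral :: "'d list"
  assumes block_pos: "0 < p" and length_neutral: "length neutral = p"
    and rank_bij: "bij_betw rank {w \<in> words. length w = k} {..<bound k}"
    and bound_mono: "i \<le> j \<Longrightarrow> bound i \<le> bound j"
    and bound_unbounded: "\<exists>l. n < bound (l * p)"
    and bound_le_rank_iff: "v @ w \<in> words \<Longrightarrow> length v = p \<Longrightarrow>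
      bound (length w) \<le> rank (v @ w) \<longleftrightarrow> v \<noteq> neutral"
begin

definition reduced :: "'d list \<Rightarrow> bool" where
  "reduced w \<longleftrightarrow> w \<in> words \<and> p dvd length w \<and> \<not> prefix neutral w"

lemma reduced_iff_take:
  "reduced w \<longleftrightarrow> w \<in> words \<and> p dvd length w \<and> take p w \<noteq> neutral"
  by (simp add: reduced_def prefix_iff_take length_neutral)

lemma rank_less_bound: "w \<in> words \<Longrightarrow> rank w < bound (length w)"
  using bij_betwE[OF rank_bij[of "length w"]] by auto

lemma reduced_rank_less_if_shorter:
  assumes "reduced v" "reduced w" "length v < length w"
  shows "rank v < rank w"
proof -
  have "p dvd length w - length v" using assms by (simp add: reduced_def dvd_diff_nat)
  then have block_fits: "length v + p \<le> length w"
    using assms(3) by (auto dest!: dvd_imp_le)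
  have "rank v < bound (length v)"
    using assms(1) by (intro rank_less_bound) (simp add: reduced_def)
  also have "\<dots> \<le> bound (length (drop p w))" using block_fits by (intro bound_mono) simp
  also have "\<dots> \<le> rank w"
    using bound_le_rank_iff[of "take p w" "drop p w"] assms(2) block_fits
    by (simp add: reduced_iff_take)
  finally show ?thesis .
qed

lemma inj_on_rank_reduced: "inj_on rank (Collect reduced)"
proof (rule inj_onI)
  fix v w assume "v \<in> Collect reduced" "w \<in> Collect reduced" and rank_eq: "rank v = rank w"
  then have reduced: "reduced v" "reduced w" by simp_all
  then have "length v = length w"
    using reduced_rank_less_if_shorter[of v w] reduced_rank_less_if_shorter[of w v] rank_eq
    by (metis less_irrefl linorder_neqE_nat)
  then show "v = w"
    using inj_onD[OF bij_betw_imp_inj_on[OF rank_bij] rank_eq] reduced by (simp add: reduced_def)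
qed

lemma ex_reduced_rank: "\<exists>w. reduced w \<and> rank w = n"
proof -
  define l where "l = (LEAST l. n < bound (l * p))"
  have "n < bound (l * p)" unfolding l_def using bound_unbounded by (rule LeastI_ex)
  then have "n \<in> rank ` {w \<in> words. length w = l * p}"
    using bij_betw_imp_surj_on[OF rank_bij] by simp
  then obtain w where w_spec: "w \<in> words" "length w = l * p" "rank w = n" by auto
  have "take p w \<noteq> neutral"
  proof (cases l)
    case 0
    then show ?thesis using w_spec block_pos length_neutral by auto
  next
    case (Suc j)
    then have "bound (j * p) \<le> n"
      using not_less_Least[of j "\<lambda>l. n < bound (l * p)"] by (simp add: l_def)
    then show ?thesis
      using bound_le_rank_iff[of "take p w" "drop p w"] w_spec Suc by simp
  qed
  then show ?thesis using w_spec by (auto simp: reduced_iff_take)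
qed

lemma bij_betw_rank_reduced: "bij_betw rank (Collect reduced) UNIV"
proof (rule bij_betw_imageI[OF inj_on_rank_reduced])
  show "rank ` Collect reduced = UNIV"
    using ex_reduced_rank by (metis UNIV_eq_I imageI mem_Collect_eq)
qed

definition word_of_rank :: "nat \<Rightarrow> 'd list" where
  "word_of_rank = the_inv_into (Collect reduced) rank"

lemma range_word_of_rank: "range word_of_rank = Collect reduced"
  unfolding word_of_rank_def
  using bij_betw_the_inv_into[OF bij_betw_rank_reduced] by (rule bij_betw_imp_surj_on)

lemma reduced_word_of_rank: "reduced (word_of_rank n)"
  using range_word_of_rank by blast

lemma rank_word_of_rank [simp]: "rank (word_of_rank n) = n"
  unfolding word_of_rank_def by (rule f_the_inv_into_f_bij_betw[OF bij_betw_rank_reduced]) simp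

lemma word_of_rank_eq_iff: "word_of_rank n = w \<longleftrightarrow> reduced w \<and> rank w = n"
  using reduced_word_of_rank rank_word_of_rank inj_onD[OF inj_on_rank_reduced] by blast

lemma word_of_rank_0_eq_Nil: "[] \<in> words \<Longrightarrow> rank [] = 0 \<Longrightarrow> word_of_rank 0 = []"
  using block_pos length_neutral by (auto simp: word_of_rank_eq_iff reduced_def)

lemma length_word_of_rank_mono: "m \<le> n \<Longrightarrow> length (word_of_rank m) \<le> length (word_of_rank n)"
  using reduced_rank_less_if_shorter[of "word_of_rank n" "word_of_rank m"]
  by (fastforce simp: reduced_word_of_rank)

end

locale right_prolongable = nonerasing \<eta> for \<eta> :: "'a list \<Rightarrow> 'a list" +
  fixes x :: 'a and p :: nat
  assumes power_pos: "0 < p" and prefix_funpow: "prefix [x] ((\<eta> ^^ p) [x])"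
    and growing: "growing \<eta> x"
begin

lemma length_funpow_le_position_iff:
  assumes "address \<eta> x (v @ w)" "length v = p"
  shows "length ((\<eta> ^^ length w) [x]) \<le> position \<eta> x (v @ w) \<longleftrightarrow> prefix_before \<eta> x v \<noteq> []"
proof -
  have address_v: "address \<eta> x v" and address_w: "address \<eta> (letter_at \<eta> x v) w"
    using assms(1) by (auto simp: address_append)
  have address_split: "prefix [x] (prefix_before \<eta> x v @ letter_at \<eta> x v # suffix_after \<eta> x v)"
    using prefix_funpow funpow_eq_address_split[OF address_v] assms(2) by simp
  show ?thesis
  proof (cases "prefix_before \<eta> x v")
    case Nil
    then have "letter_at \<eta> x v = x" using address_split by simp
    then show ?thesis
      using Nil length_funpow_address[OF address_w] by (simp add: prefix_before_append)
  next
    case (Cons y ys)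
    then have "prefix_before \<eta> x v = [x] @ ys" using address_split by simp
    then show ?thesis by (simp only: prefix_before_append funpow_append length_append) simp
  qed
qed

sublocale block_numeration "{w. address \<eta> x w}" "position \<eta> x" "\<lambda>k. length ((\<eta> ^^ k) [x])"
  p "replicate p 0"
proof
  fix v w assume "v @ w \<in> {w. address \<eta> x w}" "length v = p"
  then show "length ((\<eta> ^^ length w) [x]) \<le> position \<eta> x (v @ w) \<longleftrightarrow> v \<noteq> replicate p 0"
    using length_funpow_le_position_iff[of v w] prefix_before_eq_Nil_iff[of x v]
    by (simp add: address_append)
qed (use power_pos bij_betw_position length_funpow_mono growing_imp_unbounded[OF growing] in auto)

lemma reduced_iff_prefix_before:
  assumes "w \<noteq> []"
  shows "reduced w \<longleftrightarrow>
    address \<eta> x w \<and> p dvd length w \<and> prefix_before \<eta> x (take p w) \<noteq> []"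
proof (cases "address \<eta> x w \<and> p dvd length w")
  case True
  then have "length (take p w) = p" using assms by (simp add: dvd_imp_le)
  then show ?thesis
    using True prefix_before_eq_Nil_iff[OF address_take, of x w p] by (simp add: reduced_iff_take)
qed (auto simp: reduced_def)

lemma word_of_rank_increasing:
  assumes "m < n"
  shows "less_rad (word_of_rank m) (word_of_rank n)"
proof (cases "length (word_of_rank m) = length (word_of_rank n)")
  case True
  have "address \<eta> x (word_of_rank k)" for k
    using reduced_word_of_rank[of k] by (simp add: reduced_def)
  then show ?thesis
    using True position_less_iff_less_lex[of x "word_of_rank m" "word_of_rank n"] assms
    by (simp add: less_rad_def)
next
  case False
  then show ?thesis
    using length_word_of_rank_mono[of m n] assms by (simp add: less_rad_def)
qed

end

locale left_prolongable = nonerasing \<eta> for \<eta> :: "'a list \<Rightarrow> 'a list" +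
  fixes x :: 'a and p :: nat
  assumes power_pos: "0 < p" and suffix_funpow: "suffix [x] ((\<eta> ^^ p) [x])"
    and growing: "growing \<eta> x"
begin

definition last_address :: "nat list" where
  "last_address = tail \<eta> p x (length ((\<eta> ^^ p) [x]) - 1)"

lemma last_address_eq_iff:
  "w = last_address \<longleftrightarrow> address \<eta> x w \<and> length w = p \<and> suffix_after \<eta> x w = []"
proof -
  have "0 \<in> coposition \<eta> x ` {v. address \<eta> x v \<and> length v = p}"
    unfolding bij_betw_imp_surj_on[OF bij_betw_coposition] by (simp add: funpow_eq_Nil_iff)
  then obtain v where v_spec: "address \<eta> x v" "length v = p" "coposition \<eta> x v = 0" by auto
  have "v = last_address"
    unfolding last_address_def
    using v_spec power_pos length_funpow_address[OF v_spec(1)] by (intro tail_eqI[symmetric]) auto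
  then show ?thesis
    using v_spec inj_onD[OF bij_betw_imp_inj_on[OF bij_betw_coposition[of x p]], of v w] by auto
qed

lemma length_funpow_le_coposition_iff:
  assumes "address \<eta> x (v @ w)" "length v = p"
  shows "length ((\<eta> ^^ length w) [x]) \<le> coposition \<eta> x (v @ w) \<longleftrightarrow> suffix_after \<eta> x v \<noteq> []"
proof -
  have address_v: "address \<eta> x v" and address_w: "address \<eta> (letter_at \<eta> x v) w"
    using assms(1) by (auto simp: address_append)
  have address_split: "suffix [x] (prefix_before \<eta> x v @ letter_at \<eta> x v # suffix_after \<eta> x v)"
    using suffix_funpow funpow_eq_address_split[OF address_v] assms(2) by simp
  show ?thesis
  proof (cases "suffix_after \<eta> x v" rule: rev_cases)
    case Nil
    then have "letter_at \<eta> x v = x" using address_split by simp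
    then show ?thesis
      using Nil length_funpow_address[OF address_w] by (simp add: suffix_after_append)
  next
    case (snoc ys y)
    then have "suffix_after \<eta> x v = ys @ [x]" using address_split by (auto simp: suffix_def)
    then show ?thesis by (simp add: suffix_after_append funpow_append)
  qed
qed

sublocale block_numeration "{w. address \<eta> x w}" "coposition \<eta> x" "\<lambda>k. length ((\<eta> ^^ k) [x])"
  p last_address
proof
  fix v w assume "v @ w \<in> {w. address \<eta> x w}" "length v = p"
  then show "length ((\<eta> ^^ length w) [x]) \<le> coposition \<eta> x (v @ w) \<longleftrightarrow> v \<noteq> last_address"
    using length_funpow_le_coposition_iff[of v w] last_address_eq_iff[of v]
    by (simp add: address_append)
next
  show "length last_address = p" using last_address_eq_iff by blast
qed (use power_pos bij_betw_coposition length_funpow_mono growing_imp_unbounded[OF growing]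
    in auto)

lemma reduced_iff_suffix_after:
  assumes "w \<noteq> []"
  shows "reduced w \<longleftrightarrow>
    address \<eta> x w \<and> p dvd length w \<and> suffix_after \<eta> x (take p w) \<noteq> []"
proof (cases "address \<eta> x w \<and> p dvd length w")
  case True
  then have "length (take p w) = p" using assms by (simp add: dvd_imp_le)
  then show ?thesis
    using True last_address_eq_iff[of "take p w"] by (simp add: reduced_iff_take address_take)
qed (auto simp: reduced_def)

lemma word_of_rank_decreasing:
  assumes "m < n"
  shows "less_rev (word_of_rank n) (word_of_rank m)"
proof (cases "length (word_of_rank m) = length (word_of_rank n)")
  case True
  have "address \<eta> x (word_of_rank k)" for k
    using reduced_word_of_rank[of k] by (simp add: reduced_def)
  then show ?thesis
    using True coposition_less_iff_less_lex[of x "word_of_rank m" "word_of_rank n"] assms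
    by (simp add: less_rev_def)
next
  case False
  then show ?thesis
    using length_word_of_rank_mono[of m n] assms by (simp add: less_rev_def)
qed

end

section \<open>The numeration system of a periodic point\<close>

locale periodic_seed = nonerasing \<eta> for \<eta> :: "'a::finite list \<Rightarrow> 'a list" +
  fixes u :: "int \<Rightarrow> 'a"
  assumes periodic: "periodic_point \<eta> u"
    and growing_left: "growing \<eta> (u (-1))" and growing_right: "growing \<eta> (u 0)"
begin

abbreviation p :: nat where
  "p \<equiv> period \<eta> u"

lemma period_pos: "0 < p" and funpow_act_period: "(act \<eta> ^^ p) u = u"
proof -
  have "\<exists>q. 1 \<le> q \<and> (act \<eta> ^^ q) u = u" using periodic by (auto simp: periodic_point_def)
  then have "1 \<le> p \<and> (act \<eta> ^^ p) u = u" unfolding period_def by (rule LeastI_ex)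
  then show "0 < p" "(act \<eta> ^^ p) u = u" by simp_all
qed

lemma funpow_act_eq: "p dvd k \<Longrightarrow> (act \<eta> ^^ k) u = u"
proof (elim dvdE)
  fix l
  have "((act \<eta> ^^ p) ^^ l) u = u" by (induction l) (simp_all add: funpow_act_period)
  then show "k = p * l \<Longrightarrow> ?thesis" by (simp add: funpow_mult)
qed

lemma map_upto_right:
  "p dvd k \<Longrightarrow> map u [0..int (length ((\<eta> ^^ k) [u 0])) - 1] = (\<eta> ^^ k) [u 0]"
  using funpow_act_right[of k u] funpow_act_eq[of k] by simp

lemma map_upto_left:
  "p dvd k \<Longrightarrow> map u [- int (length ((\<eta> ^^ k) [u (-1)]))..-1] = (\<eta> ^^ k) [u (-1)]"
  using funpow_act_left[of k u] funpow_act_eq[of k] by simp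

sublocale right: right_prolongable \<eta> "u 0" p
proof
  have "0 < length ((\<eta> ^^ p) [u 0])" by (simp add: funpow_eq_Nil_iff)
  then have "0 \<le> int (length ((\<eta> ^^ p) [u 0])) - 1" by linarith
  from prefix_map_upto[OF this, of u 0] show "prefix [u 0] ((\<eta> ^^ p) [u 0])"
    unfolding map_upto_right[OF dvd_refl] by simp
qed (use period_pos growing_right in auto)

sublocale left: left_prolongable \<eta> "u (-1)" p
proof
  have "0 < length ((\<eta> ^^ p) [u (-1)])" by (simp add: funpow_eq_Nil_iff)
  then have "- int (length ((\<eta> ^^ p) [u (-1)])) \<le> - 1" by linarith
  from suffix_map_upto[OF this, of u "-1"] show "suffix [u (-1)] ((\<eta> ^^ p) [u (-1)])"
    unfolding map_upto_left[OF dvd_refl] by simp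
qed (use period_pos growing_left in auto)

lemma rep_seq_pos_path_iff:
  assumes "0 \<le> n" "address \<eta> (u 0) w" "w \<noteq> []"
  shows "rep_seq_pos \<eta> u n (path \<eta> (u 0) w) \<longleftrightarrow> right.word_of_rank (nat n) = w"
proof (cases "p dvd length w")
  case True
  let ?b = "int (length ((\<eta> ^^ length w) [u 0])) - 1"
  have "prefix (prefix_before \<eta> (u 0) w) ((\<eta> ^^ length w) [u 0])"
    unfolding funpow_eq_address_split[OF assms(2)] by simp
  then have "prefix (prefix_before \<eta> (u 0) w) (map u [0..?b])"
    by (simp only: map_upto_right[OF True])
  then have "map u [0..n - 1] = prefix_before \<eta> (u 0) w \<longleftrightarrow> position \<eta> (u 0) w = nat n"
    using map_upto_eq_prefix_iff[of "prefix_before \<eta> (u 0) w" u 0 ?b n] assms(1) by auto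
  moreover have "concat (map (\<lambda>i. fst (path \<eta> (u 0) w ! i)) (rev [length w - p..<length w])) \<noteq> []
      \<longleftrightarrow> prefix_before \<eta> (u 0) (take p w) \<noteq> []"
    using concat_leading_eq_Nil_iff[of "path \<eta> (u 0) w" "length w - p"]
    by (simp add: drop_path expansion_path)
  ultimately have "rep_seq_pos \<eta> u n (path \<eta> (u 0) w) \<longleftrightarrow>
      prefix_before \<eta> (u 0) (take p w) \<noteq> [] \<and> position \<eta> (u 0) w = nat n"
    using True admissible_path[OF assms(2,3)]
    unfolding rep_seq_pos_def Let_def length_path expansion_path by blast
  then show ?thesis
    using True assms(2,3) by (simp add: right.word_of_rank_eq_iff right.reduced_iff_prefix_before)
qed (simp add: rep_seq_pos_def right.word_of_rank_eq_iff right.reduced_def)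

lemma rep_seq_neg_path_iff:
  assumes "n < 0" "address \<eta> (u (-1)) w" "w \<noteq> []"
  shows "rep_seq_neg \<eta> u n (path \<eta> (u (-1)) w) \<longleftrightarrow> left.word_of_rank (nat (- 1 - n)) = w"
proof (cases "p dvd length w")
  case True
  let ?x = "u (-1)" and ?v = "take p w"
  let ?N = "int (length ((\<eta> ^^ length w) [?x]))"
  have "prefix (prefix_before \<eta> ?x w) ((\<eta> ^^ length w) [?x])"
    unfolding funpow_eq_address_split[OF assms(2)] by simp
  then have "prefix (prefix_before \<eta> ?x w) (map u [- ?N..-1])"
    by (simp only: map_upto_left[OF True])
  then have "- ?N \<le> n \<and> map u [- ?N..n - 1] = prefix_before \<eta> ?x w \<longleftrightarrow>
      - ?N \<le> n \<and> n = - ?N + int (position \<eta> ?x w)"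
    using map_upto_eq_prefix_iff by blast
  also have "\<dots> \<longleftrightarrow> coposition \<eta> ?x w = nat (- 1 - n)"
    using length_funpow_address[OF assms(2)] assms(1) by arith
  finally have "- ?N \<le> n \<and> map u [- ?N..n - 1] = prefix_before \<eta> ?x w \<longleftrightarrow>
      coposition \<eta> ?x w = nat (- 1 - n)" .
  moreover have "p \<le> length w" using True assms(3) by (simp add: dvd_imp_le)
  then have "snd (path \<eta> ?x w ! (length w - p)) = letter_at \<eta> ?x ?v"
    using period_pos assms(3) hd_drop_conv_nth[of "length w - p" "path \<eta> ?x w"]
      snd_hd_path[of ?v \<eta> ?x] by (simp add: drop_path)
  then have "expansion \<eta> (drop (length w - p) (path \<eta> ?x w)) @
      [snd (path \<eta> ?x w ! (length w - p))] \<noteq> (\<eta> ^^ p) [?x] \<longleftrightarrow> suffix_after \<eta> ?x ?v \<noteq> []"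
    using funpow_eq_address_split[OF address_take[OF assms(2)], of p] \<open>p \<le> length w\<close>
    by (auto simp: drop_path expansion_path)
  ultimately have "rep_seq_neg \<eta> u n (path \<eta> ?x w) \<longleftrightarrow>
      suffix_after \<eta> ?x ?v \<noteq> [] \<and> coposition \<eta> ?x w = nat (- 1 - n)"
    using True admissible_path[OF assms(2,3)]
    unfolding rep_seq_neg_def Let_def length_path expansion_path by blast
  then show ?thesis
    using True assms(2,3) by (simp add: left.word_of_rank_eq_iff left.reduced_iff_suffix_after)
qed (simp add: rep_seq_neg_def Let_def left.word_of_rank_eq_iff left.reduced_def)

lemma rep_nonneg:
  assumes "0 \<le> n"
  shows "rep \<eta> u n = 0 # right.word_of_rank (nat n)"
proof (cases "n = 0")
  case False
  let ?w = "right.word_of_rank (nat n)"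
  have "?w \<noteq> []" using False assms right.rank_word_of_rank[of "nat n"] by fastforce
  then have "digit_word (THE ms. rep_seq_pos \<eta> u n ms) = ?w"
    using rep_seq_pos_path_iff[OF assms] right.reduced_word_of_rank[of "nat n"]
    by (intro digit_word_The_eqI[where x = "u 0"])
      (auto simp: rep_seq_pos_def Let_def right.reduced_def)
  then show ?thesis using False assms by (simp add: rep_def)
qed (simp add: rep_def right.word_of_rank_0_eq_Nil)

lemma rep_neg:
  assumes "n < 0"
  shows "rep \<eta> u n = 1 # left.word_of_rank (nat (- 1 - n))"
proof (cases "n = -1")
  case False
  let ?w = "left.word_of_rank (nat (- 1 - n))"
  have "?w \<noteq> []" using False assms left.rank_word_of_rank[of "nat (- 1 - n)"] by fastforce
  then have "digit_word (THE ms. rep_seq_neg \<eta> u n ms) = ?w"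
    using rep_seq_neg_path_iff[OF assms] left.reduced_word_of_rank[of "nat (- 1 - n)"]
    by (intro digit_word_The_eqI[where x = "u (-1)"])
      (auto simp: rep_seq_neg_def Let_def left.reduced_def)
  then show ?thesis using False assms by (simp add: rep_def)
qed (simp add: rep_def left.word_of_rank_0_eq_Nil)

lemma rep_increasing:
  assumes "m < n"
  shows "prec (digits \<eta>) (rep \<eta> u m) (rep \<eta> u n)"
proof -
  have word_digits: "right.word_of_rank k \<in> lists (digits \<eta>)"
      "left.word_of_rank k \<in> lists (digits \<eta>)" for k
    using right.reduced_word_of_rank[of k] left.reduced_word_of_rank[of k] address_imp_digits
    by (auto simp: right.reduced_def left.reduced_def)
  consider (nonneg) "0 \<le> m" | (opposite) "m < 0" "0 \<le> n" | (neg) "n < 0" using assms by linarith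
  then show ?thesis
  proof cases
    case nonneg
    then have "less_rad (right.word_of_rank (nat m)) (right.word_of_rank (nat n))"
      using assms by (intro right.word_of_rank_increasing) simp
    with nonneg show ?thesis
      using assms word_digits unfolding prec_def
      by (simp add: rep_nonneg Cons_mem_words_from_singleton less_rad_def less_lex_def)
  next
    case opposite
    then show ?thesis
      using word_digits unfolding prec_def
      by (simp add: rep_nonneg rep_neg Cons_mem_words_from_singleton)
  next
    case neg
    then have "less_rev (left.word_of_rank (nat (- 1 - m))) (left.word_of_rank (nat (- 1 - n)))"
      using assms by (intro left.word_of_rank_decreasing) simp
    with neg show ?thesis
      using assms word_digits unfolding prec_def
      by (simp add: rep_neg Cons_mem_words_from_singleton less_rev_def less_lex_def)
  qed
qed

lemma range_rep_eq_reduced: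
  "range (rep \<eta> u) = Cons 0 ` Collect right.reduced \<union> Cons 1 ` Collect left.reduced"
proof (intro equalityI subsetI)
  fix s assume "s \<in> range (rep \<eta> u)"
  then obtain n where "s = rep \<eta> u n" by blast
  then show "s \<in> Cons 0 ` Collect right.reduced \<union> Cons 1 ` Collect left.reduced"
    using right.reduced_word_of_rank left.reduced_word_of_rank
    by (cases "0 \<le> n") (auto simp: rep_nonneg rep_neg)
next
  have "0 # w = rep \<eta> u (int (position \<eta> (u 0) w))" if "right.reduced w" for w
    using that right.word_of_rank_eq_iff[of "position \<eta> (u 0) w" w] by (simp add: rep_nonneg)
  moreover have "1 # w = rep \<eta> u (- 1 - int (coposition \<eta> (u (-1)) w))" if "left.reduced w" for w
    using that left.word_of_rank_eq_iff[of "coposition \<eta> (u (-1)) w" w] by (simp add: rep_neg)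
  moreover fix s assume "s \<in> Cons 0 ` Collect right.reduced \<union> Cons 1 ` Collect left.reduced"
  ultimately show "s \<in> range (rep \<eta> u)" by blast
qed

lemma zero_one_mem_digits: "0 \<in> digits \<eta>" "1 \<in> digits \<eta>"
proof -
  obtain c where "1 < length (\<eta> [c])" using growing_imp_ex_long_image[OF growing_left] by blast
  also have "\<dots> \<le> Max (range (\<lambda>c. length (\<eta> [c])))" by (rule length_image_le_Max)
  finally show "0 \<in> digits \<eta>" "1 \<in> digits \<eta>" unfolding digits_def by simp_all
qed

lemma Cons_mem_lang_iff:
  "d # w \<in> lang \<eta> (u (-1), u 0) (k + 1) \<longleftrightarrow>
    length w = k \<and> (d = 0 \<and> address \<eta> (u 0) w \<or> d = 1 \<and> address \<eta> (u (-1)) w)"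
  using zero_one_mem_digits address_imp_digits[of \<eta> "u 0" w] address_imp_digits[of \<eta> "u (-1)" w]
  by (auto simp: lang_def delta_word_Letter)

lemma Cons_mem_words_from_blocks_iff:
  assumes "d \<in> {0, 1}" "w \<in> lists (digits \<eta>)"
  shows "d # w \<in> words_from {0 # W_min \<eta> u, 1 # W_max \<eta> u} (digits \<eta>) \<longleftrightarrow>
    d = 0 \<and> prefix (replicate p 0) w \<or> d = 1 \<and> prefix left.last_address w"
proof -
  have "d # w \<in> lists (digits \<eta>)" using assms zero_one_mem_digits by auto
  then show ?thesis
    by (auto simp: mem_words_from_iff W_min_def W_max_def left.last_address_def)
qed

lemma range_rep:
  "range (rep \<eta> u) = (\<Union>l. lang \<eta> (u (-1), u 0) (l * p + 1)) -
    words_from {0 # W_min \<eta> u, 1 # W_max \<eta> u} (digits \<eta>)"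
  (is "_ = ?L - ?X")
proof (rule set_eqI)
  fix s :: "nat list"
  show "s \<in> range (rep \<eta> u) \<longleftrightarrow> s \<in> ?L - ?X"
  proof (cases s)
    case Nil
    then show ?thesis by (auto simp: range_rep_eq_reduced lang_def)
  next
    case (Cons d w)
    have "(\<exists>l. length w = l * p) \<longleftrightarrow> p dvd length w" by (auto simp: dvd_def mult.commute)
    then have "d # w \<in> ?L \<longleftrightarrow>
        p dvd length w \<and> (d = 0 \<and> address \<eta> (u 0) w \<or> d = 1 \<and> address \<eta> (u (-1)) w)"
      unfolding UN_iff Cons_mem_lang_iff by blast
    then show ?thesis
      unfolding Cons range_rep_eq_reduced
      using Cons_mem_words_from_blocks_iff[of d w] address_imp_digits[of \<eta> _ w]
      by (auto simp: right.reduced_def left.reduced_def)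
  qed
qed

end

theorem theorem22:
  fixes \<eta> :: "'a::finite list \<Rightarrow> 'a list"
    and u :: "int \<Rightarrow> 'a"
    and p :: nat
    and f :: "int \<Rightarrow> nat list"
  assumes "substitution \<eta>"
    and "periodic_point \<eta> u"
    and "growing \<eta> (u (-1))" and "growing \<eta> (u 0)"
    and "p = period \<eta> u"
    and "\<forall>n. f n \<in> words_from {[0], [1]} (digits \<eta>)"
  shows "f = rep \<eta> u \<longleftrightarrow>
    (\<forall>m n. m < n \<longrightarrow> prec (digits \<eta>) (f m) (f n)) \<and>
    range f =
      (\<Union>l::nat. lang \<eta> (u (-1), u 0) (l * p + 1))
        - words_from {0 # W_min \<eta> u, 1 # W_max \<eta> u} (digits \<eta>) \<and>
    f 0 = [0]"
proof -
  interpret periodic_seed \<eta> u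
    using assms by unfold_locales (auto simp: substitution_def)
  have rep_0: "rep \<eta> u 0 = [0]" by (simp add: rep_def)
  show ?thesis
    unfolding \<open>p = period \<eta> u\<close> range_rep[symmetric] rep_0[symmetric]
  proof
    assume "f = rep \<eta> u"
    then show "(\<forall>m n. m < n \<longrightarrow> prec (digits \<eta>) (f m) (f n)) \<and>
        range f = range (rep \<eta> u) \<and> f 0 = rep \<eta> u 0"
      by (simp add: rep_increasing)
  next
    assume "(\<forall>m n. m < n \<longrightarrow> prec (digits \<eta>) (f m) (f n)) \<and>
        range f = range (rep \<eta> u) \<and> f 0 = rep \<eta> u 0"
    then show "f = rep \<eta> u"
      by (intro increasing_int_enumeration_unique[of "prec (digits \<eta>)"])
        (auto simp: prec_asym rep_increasing)
  qed
qed

end
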